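(* Let $K,R\ge1$ be integers and let $\chi_R(z)$ be the transfer function at time $t_{n+R}$ associated with the structural scheme with parameters $(K,R)$. Assume that $\chi_R(z)=p(z)/p(-z)$, where $p$ is a Hurwitz polynomial. Then the structural scheme with parameters $(K,R)$ is A-stable, i.e. $|\chi_R(z)|\le 1$ for all $z\in\mathbb{C}$ with $\operatorname{Re} z\le0$.
   Context: A Hurwitz polynomial is a polynomial with real coefficients all of whose complex roots have strictly negative real part. Let $M=(K+1)(R+1)$ and $\ell(k,r)=1+k(R+1)+r$ for $0\le k\le K$, $0\le r\le R$. Let $\mathcal{M}$ be the $M\times M$ matrix with entries $\mathcal{M}[m,\ell(k,r)]=\frac{(m-1)!}{(m-1-k)!}r^{m-1-k}$ if $m>k$ (with $0^0=1$) and $0$ otherwise. $\mathcal{K}^R\subset\mathbb{R}^M$ is the kernel of the $(M-R)\times M$ matrix formed by the first $M-R$ rows of $\mathcal{M}$; it has dimension $R$. Let $\mathbf{a}^s=(a^s_{k,r})_{k,r}$, $s=1,\dots,R$, be a basis of $\mathcal{K}^R$. The structural scheme with parameters $(K,R)$ applied to $\phi'=\lambda\phi$, $\lambda\in\mathbb{C}$, with step $\Delta t$ and $z=\lambda\Delta t$, uses $\phi^{(k)}_{n+r}=\lambda^k\phi^{(0)}_{n+r}$ and the $R$ equations $\sum_{k=0}^K\sum_{r=0}^R a^s_{k,r}\Delta t^k\phi^{(k)}_{n+r}=0$, $s=1,\dots,R$. With $g_{s,r}(z)=\sum_{k=0}^K a^s_{k,r}z^k$, $\boldsymbol{G}(z)=(g_{s,r}(z))_{s,r=1}^R$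 and $\mathbf{b}(z)=(g_{s,0}(z))_{s=1}^R$, the transfer (amplification) function $\chi_R(z)$ is the last entry of $\boldsymbol{\chi}(z)=-\boldsymbol{G}(z)^{-1}\mathbf{b}(z)$, regarded as a rational function of $z$ with real coefficients. *)

theory Defs
  imports
    Complex_Main
    "HOL-Computational_Algebra.Normalized_Fraction"
    "HOL-Computational_Algebra.Polynomial_Factorial"
    "HOL-Computational_Algebra.Field_as_Ring"
    "Jordan_Normal_Form.Matrix_Kernel"
    "Jordan_Normal_Form.Gauss_Jordan_Elimination"
begin

definition hurwitz :: "real poly \<Rightarrow> bool" where
  "hurwitz p \<longleftrightarrow> (\<forall>w::complex. poly (map_poly complex_of_real p) w = 0 \<longrightarrow> Re w < 0)"

text \<open>Rational functions with real coefficients are elements of the fraction field of the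
  polynomial ring. Values and poles are read off from the reduced quotient, so removable
  singularities are removed.\<close>

definition ratfun_pole :: "real poly fract \<Rightarrow> complex \<Rightarrow> bool" where
  "ratfun_pole f z \<longleftrightarrow> poly (map_poly complex_of_real (snd (quot_of_fract f))) z = 0"

definition ratfun_eval :: "real poly fract \<Rightarrow> complex \<Rightarrow> complex" where
  "ratfun_eval f z =
     poly (map_poly complex_of_real (fst (quot_of_fract f))) z /
     poly (map_poly complex_of_real (snd (quot_of_fract f))) z"

definition struct_size :: "nat \<Rightarrow> nat \<Rightarrow> nat" where
  "struct_size K R = (K + 1) * (R + 1)"

text \<open>Matrices and vectors are indexed from 0, so this is the column number
  $1 + k (R+1) + r$ shifted down by one.\<close>

definition struct_index :: "nat \<Rightarrow> nat \<Rightarrow> nat \<Rightarrow> nat" where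
  "struct_index R k r = k * (R + 1) + r"

text \<open>Row \<open>i\<close> is the mathematical row $m = i + 1$; column \<open>j\<close> is
  \<open>struct_index R k r\<close> with \<open>k = j div (R + 1)\<close> and \<open>r = j mod (R + 1)\<close>.\<close>

definition struct_mat :: "nat \<Rightarrow> nat \<Rightarrow> real mat" where
  "struct_mat K R = mat (struct_size K R) (struct_size K R)
     (\<lambda>(i, j). let k = j div (R + 1); r = j mod (R + 1) in
        if k \<le> i then fact i / fact (i - k) * real r ^ (i - k) else 0)"

definition struct_mat_top :: "nat \<Rightarrow> nat \<Rightarrow> real mat" where
  "struct_mat_top K R = mat (struct_size K R - R) (struct_size K R)
     (\<lambda>(i, j). struct_mat K R $$ (i, j))"

text \<open>\<open>a s\<close>, for \<open>s = 1, \<dots>, R\<close>, is the coefficient vector of the \<open>s\<close>-th structural equation.\<close>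

definition struct_basis :: "nat \<Rightarrow> nat \<Rightarrow> (nat \<Rightarrow> real vec) \<Rightarrow> bool" where
  "struct_basis K R a \<longleftrightarrow> inj_on a {1..R} \<and>
     kernel.basis (struct_size K R) (struct_mat_top K R) (a ` {1..R})"

definition struct_g :: "nat \<Rightarrow> nat \<Rightarrow> (nat \<Rightarrow> real vec) \<Rightarrow> nat \<Rightarrow> nat \<Rightarrow> real poly" where
  "struct_g K R a s r = (\<Sum>k\<le>K. monom (a s $ struct_index R k r) k)"

definition struct_G :: "nat \<Rightarrow> nat \<Rightarrow> (nat \<Rightarrow> real vec) \<Rightarrow> real poly fract mat" where
  "struct_G K R a = mat R R (\<lambda>(i, j). Fraction_Field.Fract (struct_g K R a (i + 1) (j + 1)) 1)"

definition struct_b :: "nat \<Rightarrow> nat \<Rightarrow> (nat \<Rightarrow> real vec) \<Rightarrow> real poly fract vec" where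
  "struct_b K R a = vec R (\<lambda>i. Fraction_Field.Fract (struct_g K R a (i + 1) 0) 1)"

definition struct_chi :: "nat \<Rightarrow> nat \<Rightarrow> (nat \<Rightarrow> real vec) \<Rightarrow> real poly fract vec" where
  "struct_chi K R a = - (the (mat_inverse (struct_G K R a)) *\<^sub>v struct_b K R a)"

definition transfer_fun :: "nat \<Rightarrow> nat \<Rightarrow> (nat \<Rightarrow> real vec) \<Rightarrow> real poly fract" where
  "transfer_fun K R a = struct_chi K R a $ (R - 1)"

text \<open>Since division by zero yields zero, the absence of poles is required explicitly.\<close>

definition A_stable :: "nat \<Rightarrow> nat \<Rightarrow> (nat \<Rightarrow> real vec) \<Rightarrow> bool" where
  "A_stable K R a \<longleftrightarrow> (\<forall>z::complex. Re z \<le> 0 \<longrightarrow>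
     \<not> ratfun_pole (transfer_fun K R a) z \<and> cmod (ratfun_eval (transfer_fun K R a) z) \<le> 1)"

end

theory Submission
  imports Defs "HOL-Computational_Algebra.Fundamental_Theorem_Algebra"
    "Jordan_Normal_Form.Char_Poly"
begin

text \<open>For \<open>Re z \<le> 0\<close> and \<open>Re w < 0\<close> we have \<open>\<bar>z - w\<bar> \<le> \<bar>- cnj z - w\<bar>\<close>, as \<open>z\<close> and \<open>- cnj z\<close> are mirror images in
  the imaginary axis and \<open>z\<close> lies on the side of \<open>w\<close>. Multiplying over the roots \<open>w\<close> of \<open>p\<close> gives
  \<open>\<bar>p z\<bar> \<le> \<bar>p (- cnj z)\<bar>\<close>, and the right side is \<open>\<bar>p (- z)\<bar>\<close> because \<open>p\<close> is real. The reduced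
  denominator of \<open>p(z) / p(- z)\<close> divides \<open>p(- z)\<close>, so it has no root with \<open>Re z \<le> 0\<close>.\<close>

lemma norm_diff_le_norm_reflected_diff:
  assumes "Re z \<le> 0" and "Re w \<le> 0"
  shows "norm (z - w) \<le> norm (- cnj z - w)"
proof -
  have "0 \<le> Re z * Re w" using assms by (simp add: mult_nonpos_nonpos)
  have square: "(- x - y)\<^sup>2 = (x - y)\<^sup>2 + 4 * (x * y)" for x y :: real
    by (simp add: power2_diff)
  \<comment> \<open>\<open>z\<close> and \<open>- cnj z\<close> have the same imaginary part, so
    only the squares of the real parts differ.\<close>
  have "(norm (- cnj z - w))\<^sup>2 = (norm (z - w))\<^sup>2 + 4 * (Re z * Re w)"
    using square[of "Re z" "Re w"] by (simp add: cmod_power2)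
  with \<open>0 \<le> Re z * Re w\<close> show ?thesis by - (rule power2_le_imp_le, simp_all)
qed

text \<open>Induction on the degree, splitting off one root at a time. The cofactor of a real
  polynomial need not be real, so \<open>q\<close> is complex and the comparison point is
  \<open>- cnj z\<close> rather than \<open>- z\<close>.\<close>

lemma norm_poly_le_norm_poly_reflected:
  fixes q :: "complex poly"
  assumes "Re z \<le> 0" and "\<And>w. poly q w = 0 \<Longrightarrow> Re w \<le> 0"
  shows "norm (poly q z) \<le> norm (poly q (- cnj z))"
  using assms(2)
proof (induction "degree q" arbitrary: q)
  case 0
  then obtain c where "q = [:c:]" using degree_eq_zeroE by metis
  then show ?case by simp
next
  case (Suc n)
  then have "\<not> constant (poly q)" by (simp add: constant_degree)
  then obtain w where w: "poly q w = 0" using fundamental_theorem_of_algebra by blast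
  then obtain s where s: "q = [:- w, 1:] * s" by (auto simp: poly_eq_0_iff_dvd elim: dvdE)
  have q: "poly q x = (x - w) * poly s x" for x
    by (simp add: s algebra_simps)
  have "s \<noteq> 0"
  proof
    assume "s = 0"
    with s have "q = 0" by simp
    with Suc.hyps(2) show False by simp
  qed
  then have "degree q = Suc (degree s)" unfolding s by (subst degree_mult_eq) simp_all
  then have "n = degree s" using Suc.hyps(2) by simp
  moreover have "Re x \<le> 0" if "poly s x = 0" for x
    using Suc.prems[of x] that by (simp add: q)
  ultimately have "norm (poly s z) \<le> norm (poly s (- cnj z))"
    using Suc.hyps(1) by blast
  moreover have "norm (z - w) \<le> norm (- cnj z - w)"
    using assms(1) Suc.prems w by (blast intro: norm_diff_le_norm_reflected_diff)
  ultimately have "norm (z - w) * norm (poly s z) \<le> norm (- cnj z - w) * norm (poly s (- cnj z))"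
    by (intro mult_mono) auto
  then show ?case
    by (simp add: q norm_mult)
qed

lemma poly_map_of_real_pcompose:
  "poly (map_poly complex_of_real (pcompose p q)) z
    = poly (map_poly complex_of_real p) (poly (map_poly complex_of_real q) z)"
  by (simp add: of_real_hom.map_poly_pcompose poly_pcompose)

lemma poly_map_of_real_mult:
  "poly (map_poly complex_of_real (p * q)) z
    = poly (map_poly complex_of_real p) z * poly (map_poly complex_of_real q) z"
proof -
  interpret map_poly_comm_ring_hom complex_of_real ..
  show ?thesis by (simp add: hom_mult)
qed

lemma poly_map_of_real_eq_0_if_dvd:
  assumes "d dvd q" and "poly (map_poly complex_of_real d) z = 0"
  shows "poly (map_poly complex_of_real q) z = 0"
  using assms by (auto elim!: dvdE simp: poly_map_of_real_mult)

lemma quot_of_fract_cross_mult: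
  fixes p q :: "real poly"
  assumes "q \<noteq> 0"
  shows "fst (quot_of_fract (Fraction_Field.Fract p q)) * q
    = p * snd (quot_of_fract (Fraction_Field.Fract p q))"
  by (rule iffD1[OF eq_fract(1) Fract_quot_of_fract]) (simp_all add: assms)

text \<open>The reduced denominator divides the reduced numerator times \<open>q\<close> and is
  coprime to that numerator. Hence reduction creates no new poles.\<close>

lemma snd_quot_of_fract_dvd:
  fixes p q :: "real poly"
  assumes "q \<noteq> 0"
  shows "snd (quot_of_fract (Fraction_Field.Fract p q)) dvd q" (is "?d dvd q")
proof -
  have "?d dvd fst (quot_of_fract (Fraction_Field.Fract p q)) * q"
    unfolding quot_of_fract_cross_mult[OF assms] by (rule dvd_triv_right)
  moreover have "coprime ?d (fst (quot_of_fract (Fraction_Field.Fract p q)))"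
    by (subst coprime_commute) (rule coprime_quot_of_fract)
  ultimately show ?thesis
    using coprime_dvd_mult_right_iff by blast
qed

text \<open>Poles and values are defined through the reduced quotient; this allows computing with an
  unreduced representation wherever its denominator does not vanish.\<close>

lemma ratfun_Fract:
  assumes "poly (map_poly complex_of_real q) z \<noteq> 0"
  shows "\<not> ratfun_pole (Fraction_Field.Fract p q) z"
    and "ratfun_eval (Fraction_Field.Fract p q) z
      = poly (map_poly complex_of_real p) z / poly (map_poly complex_of_real q) z"
proof -
  let ?n = "fst (quot_of_fract (Fraction_Field.Fract p q))"
  let ?d = "snd (quot_of_fract (Fraction_Field.Fract p q))"
  have q: "q \<noteq> 0" using assms by auto
  then have d: "poly (map_poly complex_of_real ?d) z \<noteq> 0"
    using assms snd_quot_of_fract_dvd poly_map_of_real_eq_0_if_dvd by blast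
  then show "\<not> ratfun_pole (Fraction_Field.Fract p q) z" by (simp add: ratfun_pole_def)
  have "poly (map_poly complex_of_real ?n) z * poly (map_poly complex_of_real q) z
    = poly (map_poly complex_of_real p) z * poly (map_poly complex_of_real ?d) z"
    unfolding poly_map_of_real_mult[symmetric] quot_of_fract_cross_mult[OF q] ..
  then show "ratfun_eval (Fraction_Field.Fract p q) z
      = poly (map_poly complex_of_real p) z / poly (map_poly complex_of_real q) z"
    using d assms by (simp add: ratfun_eval_def frac_eq_eq)
qed

theorem theorem9p5:
  fixes K R :: nat and a :: "nat \<Rightarrow> real vec" and p :: "real poly"
  assumes "K \<ge> 1" and "R \<ge> 1"
    and "struct_basis K R a"
    and "hurwitz p"
    and "transfer_fun K R a = Fraction_Field.Fract p (pcompose p [:0, -1:])"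
  shows "A_stable K R a"
  unfolding A_stable_def assms(5)
proof (intro allI impI)
  fix z :: complex
  assume z: "Re z \<le> 0"
  let ?P = "map_poly complex_of_real p"
  let ?q = "pcompose p [:0, -1:]"
  have roots: "Re w < 0" if "poly ?P w = 0" for w
    using assms(4) that by (simp add: hurwitz_def)
  have q: "poly (map_poly complex_of_real ?q) z = poly ?P (- z)"
    by (simp add: poly_map_of_real_pcompose)
  \<comment> \<open>\<open>- z\<close> lies in the closed right half-plane; strictness of the root
    condition covers the imaginary axis.\<close>
  have nz: "poly ?P (- z) \<noteq> 0" using roots[of "- z"] z by auto
  have "norm (poly ?P z) \<le> norm (poly ?P (- cnj z))"
    using z roots by (intro norm_poly_le_norm_poly_reflected) (auto intro: less_imp_le)
  \<comment> \<open>Since \<open>- cnj z = cnj (- z)\<close> and \<open>p\<close> has real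
    coefficients, the two values are conjugate.\<close>
  also have "\<dots> = norm (poly ?P (- z))"
    using poly_cnj_real[of ?P "- z"] complex_mod_cnj[of "poly ?P (- z)"] by simp
  finally have "norm (poly ?P z / poly ?P (- z)) \<le> 1"
    using nz by (simp add: norm_divide)
  then show "\<not> ratfun_pole (Fraction_Field.Fract p ?q) z \<and>
      cmod (ratfun_eval (Fraction_Field.Fract p ?q) z) \<le> 1"
    using ratfun_Fract[of ?q z p] nz q by simp
qed

end
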